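(* Let $p$ be an odd prime and let $N_{p-2}$ be the number of permutations of $p-2$ letters with an even number of ascents. Then $$\sum_{\substack{k=1\\ k\text{ odd}}}^{\frac{p-1}{2}}\frac1k\equiv\frac12\bigl(1-2N_{p-2}\bigr)\pmod p.$$
   Context: Congruences are taken in $\mathbb{Z}_p$. For a permutation $(i_1,\dots,i_n)$ of $\{1,\dots,n\}$ (mapping $j$ to $i_j$), an ascent is an index $k$ with $i_{k+1}>i_k$. *)

theory Defs
  imports "HOL-Number_Theory.Number_Theory"
    "HOL-Combinatorics.Permutations"
begin

text \<open>A permutation \<open>(i\<^sub>1, \<dots>, i\<^sub>n)\<close> of \<open>{1..n}\<close> is represented by a function \<open>\<sigma>\<close>
  with \<open>\<sigma> permutes {1..n}\<close> and \<open>\<sigma> k = i\<^sub>k\<close>. The final index \<open>n\<close> is not a candidate for an ascent,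
  as \<open>\<sigma> (n + 1)\<close> lies outside the permutation (in the representation it is \<open>n + 1\<close>).\<close>

definition ascents :: "nat \<Rightarrow> (nat \<Rightarrow> nat) \<Rightarrow> nat set" where
  "ascents n \<sigma> = {k \<in> {1..<n}. \<sigma> (k + 1) > \<sigma> k}"

definition num_even_ascent_perms :: "nat \<Rightarrow> nat" where
  "num_even_ascent_perms n = card {\<sigma>. \<sigma> permutes {1..n} \<and> even (card (ascents n \<sigma>))}"

end

theory Submission
  imports Defs "HOL-Combinatorics.Multiset_Permutations"
begin

text \<open>Write \<open>asc\<close> for the number of ascents and let \<open>S\<close> be the sum of \<open>(-1)\<^sup>a\<^sup>s\<^sup>c\<close> over the
  permutations of \<open>n = p - 2\<close> letters, so that \<open>S = 2 N\<^sub>n - n!\<close>, where \<open>n! \<equiv> 1\<close> by Wilson's theorem.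
  Worpitzky's identity says that the binomial coefficients \<open>x + asc\<close> over \<open>n\<close>, summed over all
  permutations, give \<open>x\<^sup>n\<close>. Modulo \<open>p\<close>, their sum over the odd \<open>x \<le> p - 2\<close> is just
  \<open>(-1)\<^sup>a\<^sup>s\<^sup>c\<close>, hence \<open>S\<close> is congruent to the sum of \<open>x\<^sup>p\<^sup>-\<^sup>2 \<equiv> 1/x\<close> over these \<open>x\<close>.
  Let \<open>A\<close> and \<open>B\<close> be the sums of \<open>1/k\<close> over the odd and the even \<open>k \<le> (p - 1)/2\<close>.
  Reflecting \<open>x\<close> to \<open>p - x\<close> for \<open>x > (p - 1)/2\<close> gives \<open>S \<equiv> A - B\<close>, and reflecting all \<open>x\<close> gives
  \<open>S \<equiv> - (A + B)/2\<close>; together \<open>2 A \<equiv> - S \<equiv> 1 - 2 N\<^sub>n\<close>.\<close>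

section \<open>Ascents of lists and insertion of a new maximum\<close>

definition num_ascents :: "'a :: linorder list \<Rightarrow> nat" where
  "num_ascents xs = length (filter (\<lambda>(a, b). a < b) (zip xs (tl xs)))"

lemma num_ascents_Nil [simp]: "num_ascents [] = 0"
  and num_ascents_singleton [simp]: "num_ascents [x] = 0"
  and num_ascents_Cons_Cons [simp]:
    "num_ascents (x # y # xs) = (if x < y then 1 else 0) + num_ascents (y # xs)"
  by (simp_all add: num_ascents_def)

lemma num_ascents_less: "xs \<noteq> [] \<Longrightarrow> num_ascents xs < length xs"
  by (simp add: num_ascents_def le_less_trans[OF length_filter_le])

text \<open>A maximum placed between the two entries of an ascent replaces that ascent by another,
  so the count is kept; at any other gap, or at the end, it adds one. Fixing the head
  \<open>x\<close> leaves out the front position and lets the induction follow the gaps;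
  \<open>F\<close> must stay arbitrary in it.\<close>

lemma sum_num_ascents_insert_Cons:
  fixes F :: "nat \<Rightarrow> int"
  assumes "\<forall>y\<in>set (x # xs). y < M"
  shows "(\<Sum>i\<le>length xs. F (num_ascents (x # take i xs @ M # drop i xs))) =
    int (num_ascents (x # xs)) * F (num_ascents (x # xs)) +
    (int (length (x # xs)) - int (num_ascents (x # xs))) * F (Suc (num_ascents (x # xs)))"
  using assms
proof (induction xs arbitrary: x F)
  case Nil
  then show ?case by simp
next
  case (Cons y xs)
  \<comment> \<open>The gap after \<open>x\<close> is split off. For the later gaps the pair
    \<open>x\<close>, \<open>y\<close> contributes the constant \<open>d\<close>, so the induction
    hypothesis is used for \<open>F\<close> shifted by \<open>d\<close>.\<close>
  define d where "d = (if x < y then 1 else 0 :: nat)"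
  have "(\<Sum>i\<le>length (y # xs). F (num_ascents (x # take i (y # xs) @ M # drop i (y # xs)))) =
      F (Suc (num_ascents (y # xs))) +
      (\<Sum>i\<le>length xs. F (d + num_ascents (y # take i xs @ M # drop i xs)))"
    using Cons.prems
    by (auto simp: sum.atMost_Suc_shift d_def simp del: sum.atMost_Suc dest: less_asym)
  also have "(\<Sum>i\<le>length xs. F (d + num_ascents (y # take i xs @ M # drop i xs))) =
      int (num_ascents (y # xs)) * F (d + num_ascents (y # xs)) +
      (int (length (y # xs)) - int (num_ascents (y # xs))) * F (d + Suc (num_ascents (y # xs)))"
    using Cons.prems by (intro Cons.IH) auto
  finally show ?case
    by (cases "x < y") (simp_all add: d_def algebra_simps)
qed

text \<open>The front position creates no ascent, as \<open>M\<close> exceeds the first entry; this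
  accounts for the extra \<open>+ 1\<close> in the first weight.\<close>

lemma sum_num_ascents_insert:
  fixes F :: "nat \<Rightarrow> int"
  assumes "\<forall>y\<in>set xs. y < M"
  shows "(\<Sum>i\<le>length xs. F (num_ascents (take i xs @ M # drop i xs))) =
    (int (num_ascents xs) + 1) * F (num_ascents xs) +
    (int (length xs) - int (num_ascents xs)) * F (Suc (num_ascents xs))"
proof (cases xs)
  case Nil
  then show ?thesis by simp
next
  case (Cons x ys)
  have "(\<Sum>i\<le>length xs. F (num_ascents (take i xs @ M # drop i xs))) =
      F (num_ascents xs) + (\<Sum>i\<le>length ys. F (num_ascents (x # take i ys @ M # drop i ys)))"
    using assms
    by (auto simp: sum.atMost_Suc_shift Cons simp del: sum.atMost_Suc dest: less_asym)
  also have "(\<Sum>i\<le>length ys. F (num_ascents (x # take i ys @ M # drop i ys))) =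
      int (num_ascents xs) * F (num_ascents xs) +
      (int (length xs) - int (num_ascents xs)) * F (Suc (num_ascents xs))"
    using assms unfolding Cons by (rule sum_num_ascents_insert_Cons)
  finally show ?thesis
    by (simp add: algebra_simps)
qed

text \<open>The inverse deletes \<open>M\<close> and records how many entries stood before
  it.\<close>

lemma bij_betw_permutations_of_set_insert:
  assumes "finite A" "M \<notin> A"
  shows "bij_betw (\<lambda>(xs, i). take i xs @ M # drop i xs)
    (permutations_of_set A \<times> {..card A}) (permutations_of_set (insert M A))"
proof (rule bij_betw_byWitness[where f' = "\<lambda>ys. (remove1 M ys, length (takeWhile (\<lambda>y. y \<noteq> M) ys))"])
  have *: "M \<notin> set (take i xs)" if "xs \<in> permutations_of_set A" for i and xs :: "'a list"
    using that assms by (auto simp: permutations_of_set_def dest: in_set_takeD)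
  show "\<forall>z\<in>permutations_of_set A \<times> {..card A}.
      (\<lambda>ys. (remove1 M ys, length (takeWhile (\<lambda>y. y \<noteq> M) ys)))
        ((\<lambda>(xs, i). take i xs @ M # drop i xs) z) = z"
  proof
    fix z assume "z \<in> permutations_of_set A \<times> {..card A}"
    then obtain xs i where z: "z = (xs, i)" and xs: "xs \<in> permutations_of_set A" and i: "i \<le> card A"
      by auto
    have "takeWhile (\<lambda>y. y \<noteq> M) (take i xs @ M # drop i xs) = take i xs"
      using *[OF xs] by (subst takeWhile_append2) auto
    moreover have "remove1 M (take i xs @ M # drop i xs) = xs"
      using *[OF xs, of i] by (simp add: remove1_append)
    ultimately show "(\<lambda>ys. (remove1 M ys, length (takeWhile (\<lambda>y. y \<noteq> M) ys)))
        ((\<lambda>(xs, i). take i xs @ M # drop i xs) z) = z"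
      using i length_finite_permutations_of_set[OF xs] by (simp add: z)
  qed
  have split: "\<exists>us vs. ys = us @ M # vs \<and> M \<notin> set us \<and> M \<notin> set vs \<and>
      us @ vs \<in> permutations_of_set A" if "ys \<in> permutations_of_set (insert M A)" for ys
  proof -
    have ys: "set ys = insert M A" "distinct ys"
      using that by (auto simp: permutations_of_set_def)
    then obtain us vs where uv: "ys = us @ M # vs"
      by (metis insertI1 split_list)
    with ys have "M \<notin> set us" "M \<notin> set vs" "distinct (us @ vs)"
      by auto
    moreover from this have "set (us @ vs) = A"
      using ys(1) assms(2) uv by auto
    ultimately show ?thesis
      using uv by (blast intro: permutations_of_setI)
  qed
  show "\<forall>ys\<in>permutations_of_set (insert M A).
      (\<lambda>(xs, i). take i xs @ M # drop i xs)
        (remove1 M ys, length (takeWhile (\<lambda>y. y \<noteq> M) ys)) = ys"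
  proof
    fix ys assume "ys \<in> permutations_of_set (insert M A)"
    then obtain us vs where "ys = us @ M # vs" "M \<notin> set us"
      using split by blast
    moreover from this have "takeWhile (\<lambda>y. y \<noteq> M) ys = us"
      by (simp add: takeWhile_tail) (metis append_Nil2 takeWhile_eq_all_conv)
    ultimately show "(\<lambda>(xs, i). take i xs @ M # drop i xs)
        (remove1 M ys, length (takeWhile (\<lambda>y. y \<noteq> M) ys)) = ys"
      by (simp add: remove1_append)
  qed
  show "(\<lambda>(xs, i). take i xs @ M # drop i xs) ` (permutations_of_set A \<times> {..card A})
      \<subseteq> permutations_of_set (insert M A)"
  proof safe
    fix xs :: "'a list" and i :: nat
    assume "xs \<in> permutations_of_set A"
    then have xs: "set xs = A" "distinct xs"
      by (auto simp: permutations_of_set_def)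
    have "set (take i xs) \<union> set (drop i xs) = A"
      by (metis append_take_drop_id set_append xs(1))
    moreover have "set (take i xs) \<inter> set (drop i xs) = {}"
      using xs(2) by (metis append_take_drop_id distinct_append)
    ultimately show "take i xs @ M # drop i xs \<in> permutations_of_set (insert M A)"
      using xs assms by (auto simp: permutations_of_set_def)
  qed
  show "(\<lambda>ys. (remove1 M ys, length (takeWhile (\<lambda>y. y \<noteq> M) ys))) ` permutations_of_set (insert M A)
      \<subseteq> permutations_of_set A \<times> {..card A}"
  proof
    fix z assume "z \<in> (\<lambda>ys. (remove1 M ys, length (takeWhile (\<lambda>y. y \<noteq> M) ys))) `
      permutations_of_set (insert M A)"
    then obtain ys where ys: "ys \<in> permutations_of_set (insert M A)"
      and z: "z = (remove1 M ys, length (takeWhile (\<lambda>y. y \<noteq> M) ys))"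
      by blast
    obtain us vs where uv: "ys = us @ M # vs" "M \<notin> set us" "us @ vs \<in> permutations_of_set A"
      using split[OF ys] by blast
    have "takeWhile (\<lambda>y. y \<noteq> M) ys = us"
      using uv by (simp add: takeWhile_tail) (metis append_Nil2 takeWhile_eq_all_conv)
    moreover have "length us \<le> card A"
      using length_finite_permutations_of_set[OF uv(3)] by simp
    ultimately show "z \<in> permutations_of_set A \<times> {..card A}"
      using uv z by (simp add: remove1_append)
  qed
qed

section \<open>Worpitzky's identity\<close>

text \<open>The weights are those of \<open>sum_num_ascents_insert\<close>. With \<open>c\<close>
  and \<open>d\<close> as below, Pascal's rule turns the left side into
  \<open>(n + 1) * (c + d) - (k + 1) * c\<close>, and absorption gives
  \<open>(n + 1) * (c + d) = (x + k + 1) * c\<close>.\<close>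

lemma binomial_step:
  assumes "k \<le> n"
  shows "(int k + 1) * int ((x + k) choose Suc n) + (int n - int k) * int ((x + Suc k) choose Suc n)
    = int x * int ((x + k) choose n)"
proof -
  define c where "c = int ((x + k) choose n)"
  define d where "d = int ((x + k) choose Suc n)"
  have "int (Suc n * (Suc (x + k) choose Suc n)) = int (Suc (x + k) * ((x + k) choose n))"
    by (simp only: Suc_times_binomial)
  then have "(int n + 1) * (c + d) = (int x + int k + 1) * c"
    by (simp add: c_def d_def algebra_simps)
  moreover have "int ((x + Suc k) choose Suc n) = c + d"
    by (simp add: c_def d_def)
  ultimately show ?thesis
    unfolding c_def[symmetric] d_def[symmetric] by (simp add: algebra_simps)
qed

text \<open>Inserting a new maximum in all positions of one permutation multiplies its binomial term
  by \<open>x\<close>.\<close>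

theorem Worpitzky:
  fixes A :: "'a :: linorder set"
  assumes "finite A"
  shows "(\<Sum>xs\<in>permutations_of_set A. int ((x + num_ascents xs) choose card A)) = int x ^ card A"
  using assms
proof (induction A rule: finite_linorder_max_induct)
  case empty
  then show ?case by simp
next
  case (insert M A)
  then have "M \<notin> A" by auto
  define n where "n = card A"
  have "(\<Sum>xs\<in>permutations_of_set (insert M A). int ((x + num_ascents xs) choose Suc n)) =
      (\<Sum>(xs, i)\<in>permutations_of_set A \<times> {..n}.
        int ((x + num_ascents (take i xs @ M # drop i xs)) choose Suc n))"
    unfolding n_def
    by (subst sum.reindex_bij_betw[OF bij_betw_permutations_of_set_insert[OF insert(1) \<open>M \<notin> A\<close>],
          symmetric]) (simp add: case_prod_unfold)
  also have "\<dots> = (\<Sum>xs\<in>permutations_of_set A. \<Sum>i\<le>length xs.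
        int ((x + num_ascents (take i xs @ M # drop i xs)) choose Suc n))"
    by (subst sum.cartesian_product[symmetric])
      (auto intro!: sum.cong simp: n_def length_finite_permutations_of_set)
  also have "\<dots> = (\<Sum>xs\<in>permutations_of_set A. int x * int ((x + num_ascents xs) choose n))"
  proof (rule sum.cong)
    fix xs assume "xs \<in> permutations_of_set A"
    then have xs: "set xs = A" "length xs = n"
      by (auto simp: n_def permutations_of_set_def distinct_card)
    then have "num_ascents xs \<le> n"
      using num_ascents_less[of xs] by (cases "xs = []") auto
    then show "(\<Sum>i\<le>length xs. int ((x + num_ascents (take i xs @ M # drop i xs)) choose Suc n)) =
        int x * int ((x + num_ascents xs) choose n)"
      using sum_num_ascents_insert[of xs M "\<lambda>k. int ((x + k) choose Suc n)"] insert(2) xs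
      by (simp only: binomial_step)
  qed simp
  also have "\<dots> = int x ^ Suc n"
    using insert.IH by (simp add: n_def flip: sum_distrib_left)
  finally show ?case
    using \<open>M \<notin> A\<close> insert(1) by (simp add: n_def)
qed

section \<open>The signed count of permutations by ascents\<close>

lemma bij_betw_permutes_permutations_of_set:
  "bij_betw (\<lambda>\<sigma>. map \<sigma> [1..<Suc n]) {\<sigma>. \<sigma> permutes {1..n}} (permutations_of_set {1..n})"
proof -
  let ?f = "\<lambda>\<sigma>. map \<sigma> [1..<Suc n]"
  let ?P = "{\<sigma>. \<sigma> permutes {1..n}}"
  have inj: "inj_on ?f ?P"
  proof (rule inj_onI, rule ext)
    fix \<sigma> \<tau> k
    assume "\<sigma> \<in> ?P" "\<tau> \<in> ?P" and eq: "?f \<sigma> = ?f \<tau>"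
    then have "\<sigma> permutes {1..n}" "\<tau> permutes {1..n}" by auto
    moreover have "\<sigma> k = \<tau> k" if "k \<in> {1..n}"
      using eq that unfolding map_eq_conv by (cases "k = n") auto
    ultimately show "\<sigma> k = \<tau> k"
      by (metis permutes_not_in)
  qed
  have sub: "?f ` ?P \<subseteq> permutations_of_set {1..n}"
  proof safe
    fix \<sigma> :: "nat \<Rightarrow> nat"
    assume \<sigma>: "\<sigma> permutes {1..n}"
    have "set (?f \<sigma>) = \<sigma> ` {1..n}"
      by (simp add: atLeastLessThanSuc_atLeastAtMost del: upt_Suc)
    moreover have "distinct (?f \<sigma>)"
      using permutes_inj_on[OF \<sigma>] by (simp add: distinct_map del: upt_Suc)
    ultimately show "?f \<sigma> \<in> permutations_of_set {1..n}"
      using permutes_image[OF \<sigma>] by (intro permutations_of_setI) simp_all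
  qed
  \<comment> \<open>Surjectivity follows by counting, since both sides have \<open>n!\<close>
    elements.\<close>
  have "card (?f ` ?P) = card (permutations_of_set {1..n})"
    using inj by (simp add: card_image card_permutations)
  then have "?f ` ?P = permutations_of_set {1..n}"
    by (intro card_subset_eq sub) simp_all
  with inj show ?thesis
    by (simp add: bij_betw_def)
qed

lemma num_ascents_map_upt: "num_ascents (map \<sigma> [1..<Suc n]) = card (ascents n \<sigma>)"
proof -
  have "num_ascents (map \<sigma> [1..<Suc n]) = card {i. i < n - 1 \<and> \<sigma> (Suc i) < \<sigma> (Suc (Suc i))}"
    unfolding num_ascents_def length_filter_conv_card
    by (rule arg_cong[where f = card]) (auto simp: nth_tl simp del: upt_Suc)
  \<comment> \<open>List positions start at 0, the indices in \<open>ascents\<close> at 1.\<close>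
  also have "\<dots> = card (Suc ` {i. i < n - 1 \<and> \<sigma> (Suc i) < \<sigma> (Suc (Suc i))})"
    by (simp add: card_image)
  also have "Suc ` {i. i < n - 1 \<and> \<sigma> (Suc i) < \<sigma> (Suc (Suc i))} = ascents n \<sigma>"
    by (force simp: ascents_def image_iff gr0_conv_Suc Suc_le_eq)
  finally show ?thesis .
qed

lemma sum_sign_num_ascents:
  "(\<Sum>xs\<in>permutations_of_set {1..n}. (-1) ^ num_ascents xs)
    = 2 * int (num_even_ascent_perms n) - fact n"
proof -
  let ?P = "{\<sigma>. \<sigma> permutes {1..n}}"
  have fin: "finite ?P" by (simp add: finite_permutations)
  have "(\<Sum>xs\<in>permutations_of_set {1..n}. (-1) ^ num_ascents xs)
      = (\<Sum>\<sigma>\<in>?P. (-1 :: int) ^ card (ascents n \<sigma>))"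
    by (subst sum.reindex_bij_betw[OF bij_betw_permutes_permutations_of_set, symmetric])
      (simp only: num_ascents_map_upt)
  also have "\<dots> = (\<Sum>\<sigma>\<in>?P. 2 * (if even (card (ascents n \<sigma>)) then 1 else 0) - 1)"
    by (intro sum.cong) auto
  also have "\<dots> = 2 * (\<Sum>\<sigma>\<in>?P. if even (card (ascents n \<sigma>)) then 1 else 0) - int (card ?P)"
    by (simp add: sum_subtractf sum_distrib_left)
  also have "(\<Sum>\<sigma>\<in>?P. if even (card (ascents n \<sigma>)) then 1 else 0 :: int)
      = int (num_even_ascent_perms n)"
    using fin by (simp add: num_even_ascent_perms_def sum.If_cases Int_def)
  also have "card ?P = fact n"
    by (simp add: card_permutations)
  finally show ?thesis by simp
qed

section \<open>Binomial sums modulo a prime\<close>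

text \<open>The prime \<open>p\<close> divides \<open>y!\<close>, but neither
  \<open>(p - 2)!\<close> nor \<open>(y - (p - 2))!\<close>, because
  \<open>y - (p - 2) < p\<close>.\<close>

lemma binomial_prime_minus_2_cong_0:
  assumes "prime p" "p \<le> y" "y + 2 < 2 * p"
  shows "[y choose (p - 2) = 0] (mod p)"
proof -
  have p: "2 \<le> p" using assms(1) by (rule prime_ge_2_nat)
  have "fact (p - 2) * fact (y - (p - 2)) * (y choose (p - 2)) = fact y"
    using assms by (intro binomial_fact_lemma) simp
  moreover have "p dvd fact y"
    using assms by (simp add: prime_dvd_fact_iff)
  moreover have "\<not> p dvd fact (p - 2)" "\<not> p dvd fact (y - (p - 2))"
    using assms p by (simp_all add: prime_dvd_fact_iff)
  ultimately show ?thesis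
    using assms(1) by (metis cong_0_iff prime_dvd_mult_iff)
qed

text \<open>Only the terms with \<open>x + k = p - 2\<close> (where the binomial coefficient is \<open>1\<close>) and \<open>x + k = p - 1\<close>
  (where it is \<open>p - 1\<close>) survive modulo \<open>p\<close>, and the parity of \<open>k\<close> decides which of the two occurs.\<close>

lemma sum_odd_binomial_cong:
  assumes "prime p" "odd p" "k + 2 < p"
  shows "[(\<Sum>x\<in>{x \<in> {1..p - 2}. odd x}. int ((x + k) choose (p - 2))) = (-1) ^ k] (mod int p)"
proof -
  have p: "3 \<le> p" using assms by linarith
  have *: "[int (y choose (p - 2)) =
      (if y = p - 2 then 1 else 0) - (if y = p - 1 then 1 else 0)] (mod int p)"
    if "y + 2 < 2 * p" for y
  proof -
    consider "y < p - 2" | "y = p - 2" | "y = p - 1" | "p \<le> y" by linarith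
    then show ?thesis
    proof cases
      case 3
      have "(p - 1) choose (p - 2) = p - 1"
        using binomial_symmetric[of 1 "p - 1"] p by (simp add: numeral_2_eq_2)
      then show ?thesis using 3 p by (simp add: cong_iff_dvd_diff of_nat_diff)
    next
      case 4
      then have "y \<noteq> p - 2" "y \<noteq> p - 1" using p by linarith+
      with 4 show ?thesis
        using binomial_prime_minus_2_cong_0[OF assms(1) _ that]
        by (simp flip: cong_int_iff)
    next
      case 1
      then have "y \<noteq> p - 1" by linarith
      with 1 show ?thesis by (simp add: binomial_eq_0)
    next
      case 2
      with p have "y \<noteq> p - 1" by linarith
      with 2 show ?thesis by simp
    qed
  qed
  let ?O = "{x \<in> {1..p - 2}. odd x}"
  have "[(\<Sum>x\<in>?O. int ((x + k) choose (p - 2))) =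
      (\<Sum>x\<in>?O. (if x + k = p - 2 then 1 else 0) - (if x + k = p - 1 then 1 else 0))] (mod int p)"
    by (intro cong_sum *) (use assms in auto)
  also have "(\<Sum>x\<in>?O. (if x + k = p - 2 then 1 else 0) - (if x + k = p - 1 then 1 else 0 :: int)) =
      (\<Sum>x\<in>?O. if x = p - 2 - k then 1 else 0) - (\<Sum>x\<in>?O. if x = p - 1 - k then 1 else 0)"
    unfolding sum_subtractf using assms
    by (intro arg_cong2[where f = "(-)"] sum.cong if_cong) auto
  also have "\<dots> = (if p - 2 - k \<in> ?O then 1 else 0) - (if p - 1 - k \<in> ?O then 1 else 0)"
    by (simp add: sum.delta)
  \<comment> \<open>As \<open>p\<close> is odd, \<open>p - 2 - k\<close> is odd for even
    \<open>k\<close> and \<open>p - 1 - k\<close> for odd \<open>k\<close>; \<open>k + 2 < p\<close>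
    keeps the odd one of them in the range.\<close>
  also have "\<dots> = (-1) ^ k"
  proof -
    obtain h where h: "p = 2 * h + 1" using assms(2) oddE by blast
    show ?thesis
    proof (cases "even k")
      case True
      then obtain j where "k = 2 * j" by blast
      with h assms(3) show ?thesis by (auto)
    next
      case False
      then obtain j where "k = 2 * j + 1" using oddE by blast
      with h assms(3) show ?thesis by auto
    qed
  qed
  finally show ?thesis .
qed

text \<open>A double sum of binomial coefficients is evaluated in both orders: summing over
  \<open>x\<close> first gives the signs, summing over the permutations first gives the
  powers.\<close>

lemma sum_sign_num_ascents_cong:
  assumes "prime p" "odd p"
  shows "[(\<Sum>xs\<in>permutations_of_set {1..p - 2}. (-1) ^ num_ascents xs) =
    (\<Sum>x\<in>{x \<in> {1..p - 2}. odd x}. int x ^ (p - 2))] (mod int p)"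
proof -
  have p: "3 \<le> p" using assms prime_ge_2_nat[of p] by (cases "p = 2") auto
  let ?O = "{x \<in> {1..p - 2}. odd x}"
  let ?P = "permutations_of_set {1..p - 2}"
  have "[(\<Sum>xs\<in>?P. (-1) ^ num_ascents xs) =
      (\<Sum>xs\<in>?P. \<Sum>x\<in>?O. int ((x + num_ascents xs) choose (p - 2)))] (mod int p)"
  proof (rule cong_sum, rule cong_sym, rule sum_odd_binomial_cong[OF assms])
    fix xs assume "xs \<in> ?P"
    then have "length xs = p - 2"
      by (simp add: length_finite_permutations_of_set)
    \<comment> \<open>As \<open>p\<close> is at least 3, the list is nonempty and has at most
      \<open>p - 3\<close> ascents.\<close>
    with num_ascents_less[of xs] p show "num_ascents xs + 2 < p"
      by (cases xs) auto
  qed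
  also have "(\<Sum>xs\<in>?P. \<Sum>x\<in>?O. int ((x + num_ascents xs) choose (p - 2))) =
      (\<Sum>x\<in>?O. int x ^ (p - 2))"
    by (subst sum.swap) (use Worpitzky[of "{1..p - 2}"] in simp)
  finally show ?thesis .
qed

section \<open>Inverses and power sums modulo a prime\<close>

lemma fact_prime_minus_2_cong:
  assumes "prime p"
  shows "[fact (p - 2) = 1] (mod int p)"
proof -
  obtain m where m: "p = Suc (Suc m)"
    using prime_ge_2_nat[OF assms] by (metis add_2_eq_Suc le_Suc_ex)
  have "[fact (p - 1) = -1] (mod int p)"
    using wilson_theorem[OF assms] .
  then have "int p dvd (int p - 1) * fact (p - 2) + 1"
    by (simp add: cong_iff_dvd_diff m)
  then have "int p dvd int p * fact (p - 2) - ((int p - 1) * fact (p - 2) + 1)"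
    by (intro dvd_diff) auto
  then show ?thesis
    by (simp add: cong_iff_dvd_diff algebra_simps)
qed

text \<open>By Fermat's little theorem both sides are inverses of \<open>k\<close>, which can be
  cancelled.\<close>

lemma modular_inverse_cong_power:
  assumes "prime p" "\<not> p dvd k"
  shows "[modular_inverse (int p) (int k) = int k ^ (p - 2)] (mod int p)"
proof -
  have cop: "coprime (int k) (int p)"
    using prime_imp_coprime[OF assms] by (simp add: coprime_commute)
  have "[k ^ (p - 1) = 1] (mod p)"
    using assms by (rule fermat_theorem)
  then have "[int (k ^ (p - 1)) = int 1] (mod int p)"
    by (simp only: cong_int_iff)
  moreover have "k ^ (p - 1) = k * k ^ (p - 2)"
    using prime_ge_2_nat[OF assms(1)] by (metis Suc_diff_le Suc_1 diff_Suc_Suc power_Suc)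
  ultimately have "[int k * int k ^ (p - 2) = 1] (mod int p)"
    by (simp only: of_nat_mult of_nat_power of_nat_1)
  moreover have "[int k * modular_inverse (int p) (int k) = 1] (mod int p)"
    using cop by (rule cong_modular_inverse1)
  ultimately show ?thesis
    using cop by (meson cong_mult_lcancel cong_sym cong_trans)
qed

lemma odd_power_reflect_cong:
  assumes "odd m" "k \<le> p"
  shows "[int (p - k) ^ m = - (int k ^ m)] (mod int p)"
proof -
  have "[int (p - k) = - int k] (mod int p)"
    using assms by (simp add: of_nat_diff cong_iff_dvd_diff)
  then have "[int (p - k) ^ m = (- int k) ^ m] (mod int p)"
    by (rule cong_pow)
  with assms show ?thesis by simp
qed

lemma double_odd_sum_cong:
  assumes "prime p" "odd p"
  shows "[2 * (\<Sum>k\<in>{k \<in> {1..(p - 1) div 2}. odd k}. int k ^ (p - 2)) =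
    - (\<Sum>k\<in>{k \<in> {1..p - 2}. odd k}. int k ^ (p - 2))] (mod int p)"
proof -
  have p: "3 \<le> p" using assms prime_ge_2_nat[of p] by (cases "p = 2") auto
  obtain h where h: "p = 2 * h + 1" using assms(2) oddE by blast
  define u where "u k = int k ^ (p - 2)" for k
  have refl: "[u (p - k) = - u k] (mod int p)" if "k \<le> p" for k
    unfolding u_def using that assms p by (intro odd_power_reflect_cong) auto
  define S where "S = sum u {k \<in> {1..p - 2}. odd k}"
  define Od where "Od = sum u {k \<in> {1..h}. odd k}"
  define Ev where "Ev = sum u {k \<in> {1..h}. even k}"
  \<comment> \<open>The odd \<open>k\<close> above \<open>h\<close> correspond to the even
    \<open>p - k\<close> up to \<open>h\<close>, and reflection changes the sign since
    \<open>p - 2\<close> is odd.\<close>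
  have S1: "[S = Od - Ev] (mod int p)"
  proof -
    have "S = Od + sum u {k \<in> {h + 1..p - 2}. odd k}"
      unfolding S_def Od_def using p h
      by (subst sum.union_disjoint[symmetric]) (auto intro!: sum.cong)
    also have "sum u {k \<in> {h + 1..p - 2}. odd k} = (\<Sum>k\<in>{k \<in> {1..h}. even k}. u (p - k))"
      by (rule sum.reindex_bij_witness[of _ "\<lambda>k. p - k" "\<lambda>k. p - k"])
        (use h in \<open>auto elim!: evenE\<close>)
    also have "[Od + (\<Sum>k\<in>{k \<in> {1..h}. even k}. u (p - k)) =
        Od + (\<Sum>k\<in>{k \<in> {1..h}. even k}. - u k)] (mod int p)"
      by (intro cong_add cong_refl cong_sum refl) (use h in auto)
    finally show ?thesis by (simp add: Ev_def sum_negf)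
  qed
  \<comment> \<open>The odd numbers up to \<open>p - 2\<close> are the \<open>p - 2 * j\<close> with
    \<open>j\<close> in \<open>{1..h}\<close>. Reflection leaves \<open>- u (2 * j)\<close>, and the
    outer factor 2 cancels \<open>2 ^ (p - 2)\<close> by Fermat.\<close>
  have S2: "[2 * S = - (Od + Ev)] (mod int p)"
  proof -
    have "S = (\<Sum>j\<in>{1..h}. u (p - 2 * j))"
      unfolding S_def
      by (rule sum.reindex_bij_witness[of _ "\<lambda>j. p - 2 * j" "\<lambda>k. (p - k) div 2"])
        (use h in \<open>auto elim!: oddE\<close>)
    also have "[\<dots> = (\<Sum>j\<in>{1..h}. - u (2 * j))] (mod int p)"
      by (intro cong_sum refl) (use h in auto)
    also have "(\<Sum>j\<in>{1..h}. - u (2 * j)) = - (2 ^ (p - 2) * sum u {1..h})"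
      by (simp add: u_def power_mult_distrib sum_negf sum_distrib_left)
    finally have "[2 * S = 2 * (- (2 ^ (p - 2) * sum u {1..h}))] (mod int p)"
      by (intro cong_mult cong_refl)
    also have "2 * (- (2 ^ (p - 2) * sum u {1..h})) = (2 * 2 ^ (p - 2)) * (- sum u {1..h})"
      by simp
    also have "[\<dots> = 1 * (- sum u {1..h})] (mod int p)"
    proof (intro cong_mult cong_refl)
      have "\<not> p dvd 2" using p by (auto dest: dvd_imp_le)
      then have "[int (2 ^ (p - 1)) = int 1] (mod int p)"
        using fermat_theorem[OF assms(1)] by (simp only: cong_int_iff)
      moreover have "p - 1 = Suc (p - 2)" using p by simp
      ultimately show "[2 * 2 ^ (p - 2) = 1] (mod int p)" by simp
    qed
    also have "sum u {1..h} = Od + Ev"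
      unfolding Od_def Ev_def
      by (subst sum.union_disjoint[symmetric]) (auto intro!: sum.cong)
    finally show ?thesis by simp
  qed
  \<comment> \<open>Subtracting the two congruences eliminates \<open>Ev\<close>.\<close>
  have "[2 * S - S = - (Od + Ev) - (Od - Ev)] (mod int p)"
    using S1 S2 by (intro cong_diff)
  then have "[S = - (2 * Od)] (mod int p)" by simp
  then have "[2 * Od = - S] (mod int p)"
    by (metis cong_minus_minus_iff cong_sym minus_minus)
  moreover have "(p - 1) div 2 = h" using h by simp
  ultimately show ?thesis by (simp add: Od_def S_def u_def)
qed

theorem theorem4:
  fixes p :: nat
  assumes "prime p" and "odd p"
  shows "[(\<Sum>k \<in> {k \<in> {1..(p - 1) div 2}. odd k}. modular_inverse (int p) (int k))
            = modular_inverse (int p) 2 * (1 - 2 * int (num_even_ascent_perms (p - 2)))] (mod int p)"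
proof -
  let ?O = "{k \<in> {1..(p - 1) div 2}. odd k}"
  let ?S = "\<Sum>k\<in>{k \<in> {1..p - 2}. odd k}. int k ^ (p - 2)"
  let ?inv2 = "modular_inverse (int p) 2"
  have "[?S = 2 * int (num_even_ascent_perms (p - 2)) - fact (p - 2)] (mod int p)"
    using sum_sign_num_ascents_cong[OF assms] unfolding sum_sign_num_ascents by (rule cong_sym)
  also have "[2 * int (num_even_ascent_perms (p - 2)) - fact (p - 2) =
      2 * int (num_even_ascent_perms (p - 2)) - 1] (mod int p)"
    by (intro cong_diff cong_refl fact_prime_minus_2_cong assms)
  finally have S: "[- ?S = - (2 * int (num_even_ascent_perms (p - 2)) - 1)] (mod int p)"
    by (simp only: cong_minus_minus_iff)
  have inv2: "[?inv2 * 2 = 1] (mod int p)"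
    using assms by (intro cong_modular_inverse2) auto
  have "[(\<Sum>k\<in>?O. modular_inverse (int p) (int k)) = (\<Sum>k\<in>?O. int k ^ (p - 2))] (mod int p)"
    by (intro cong_sum modular_inverse_cong_power assms) (auto dest: dvd_imp_le)
  \<comment> \<open>The factor \<open>?inv2 * 2\<close>, congruent to 1, supplies the 2 that
    \<open>double_odd_sum_cong\<close> requires.\<close>
  also have "[(\<Sum>k\<in>?O. int k ^ (p - 2)) = (?inv2 * 2) * (\<Sum>k\<in>?O. int k ^ (p - 2))] (mod int p)"
    using cong_mult[OF cong_sym[OF inv2] cong_refl] by simp
  also have "(?inv2 * 2) * (\<Sum>k\<in>?O. int k ^ (p - 2)) = ?inv2 * (2 * (\<Sum>k\<in>?O. int k ^ (p - 2)))"
    by simp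
  also have "[\<dots> = ?inv2 * - ?S] (mod int p)"
    by (intro cong_mult cong_refl double_odd_sum_cong assms)
  also have "[?inv2 * - ?S = ?inv2 * - (2 * int (num_even_ascent_perms (p - 2)) - 1)] (mod int p)"
    by (intro cong_mult cong_refl S)
  finally show ?thesis by simp
qed

end
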